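(* Let $W \in \mathbb{R}^{n\times n}$ be a symmetric indefinite matrix and let $T \in \mathbb{R}^{n\times n}$ be symmetric positive definite. Let $\alpha > 0$ and $\gamma > 0$, and suppose that for every $x \in \mathbb{C}^n$ with $\|x\|_2 = 1$, $$\alpha > \frac{1}{2}\left(x^{*}WT^{-1}Wx - x^{*}Tx\right).$$ Then the preconditioned matrix $\mathscr{P}_{\mathrm{VBP}}^{-1}\mathscr{A}$ has the eigenvalue $1$ with algebraic multiplicity at least $n$. Furthermore, the remaining $n$ eigenvalues (counted with algebraic multiplicity) are all real and lie in the positive real interval $$\left[\frac{\lambda_{\min}(T)+\sigma_{\min}^2(W)/\lambda_{\max}(T)}{\alpha+\lambda_{\max}(T)},\ \frac{\lambda_{\max}(T)+\sigma_{\max}^2(W)/\lambda_{\min}(T)}{\alpha+\lambda_{\min}(T)}\right].$$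
   Context: A real symmetric matrix is indefinite if it has both positive and negative eigenvalues. $x^{*}$ is the conjugate transpose of $x$ and $\|\cdot\|_2$ the Euclidean norm. $\lambda_{\min}(T),\lambda_{\max}(T)$ are the smallest and largest eigenvalues of $T$; $\sigma_{\min}(W),\sigma_{\max}(W)$ are the smallest and largest singular values of $W$. The $2n\times 2n$ real block matrices are $$\mathscr{A} = \begin{bmatrix} T & -W\\ W & T\end{bmatrix},\qquad \mathscr{P}_{\mathrm{VBP}} = \begin{bmatrix} T+\alpha I & -\gamma W\\ 0 & I\end{bmatrix}\begin{bmatrix} I & 0\\ W & T\end{bmatrix} = \begin{bmatrix} T+\alpha I-\gamma W^2 & -\gamma WT\\ W & T\end{bmatrix}.$$ *)

theory Defs
  imports
    "Jordan_Normal_Form.Spectral_Radius"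
    "Jordan_Normal_Form.Gauss_Jordan_Elimination"
    "HOL-Analysis.L2_Norm"
begin

definition symmetric_mat :: "'a mat \<Rightarrow> bool" where
  "symmetric_mat M \<longleftrightarrow> transpose_mat M = M"

definition pos_def_mat :: "real mat \<Rightarrow> bool" where
  "pos_def_mat M \<longleftrightarrow> square_mat M \<and>
     (\<forall>x \<in> carrier_vec (dim_row M). x \<noteq> 0\<^sub>v (dim_row M) \<longrightarrow> x \<bullet> (M *\<^sub>v x) > 0)"

text \<open>Only meant for symmetric matrices, all of whose eigenvalues are real; likewise
  \<open>lambda_min\<close> and \<open>lambda_max\<close> below.\<close>

definition indefinite_mat :: "real mat \<Rightarrow> bool" where
  "indefinite_mat M \<longleftrightarrow> (\<exists>k. eigenvalue M k \<and> k > 0) \<and> (\<exists>k. eigenvalue M k \<and> k < 0)"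

definition lambda_min :: "real mat \<Rightarrow> real" where
  "lambda_min M = Min (spectrum M)"

definition lambda_max :: "real mat \<Rightarrow> real" where
  "lambda_max M = Max (spectrum M)"

text \<open>For square matrices the eigenvalues of the Gram matrix give all singular values,
  including \<open>0\<close>.\<close>

definition singular_values :: "real mat \<Rightarrow> real set" where
  "singular_values M = sqrt ` spectrum (transpose_mat M * M)"

definition sigma_min :: "real mat \<Rightarrow> real" where
  "sigma_min M = Min (singular_values M)"

definition sigma_max :: "real mat \<Rightarrow> real" where
  "sigma_max M = Max (singular_values M)"

abbreviation cmat :: "real mat \<Rightarrow> complex mat" where
  "cmat M \<equiv> map_mat complex_of_real M"

definition vec_norm2 :: "complex vec \<Rightarrow> real" where
  "vec_norm2 x = L2_set (\<lambda>i. cmod (x $ i)) {..<dim_vec x}"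

text \<open>\<open>u \<bullet>c v\<close> conjugates its second argument, so this is \<open>x\<^sup>* M x\<close>.\<close>

definition quad_form :: "complex mat \<Rightarrow> complex vec \<Rightarrow> complex" where
  "quad_form M x = (M *\<^sub>v x) \<bullet>c x"

text \<open>Unspecified for singular matrices.\<close>

definition mat_inv :: "'a :: field mat \<Rightarrow> 'a mat" where
  "mat_inv M = the (mat_inverse M)"

definition block_A :: "real mat \<Rightarrow> real mat \<Rightarrow> real mat" where
  "block_A W T = four_block_mat T (- W) W T"

definition P_VBP :: "nat \<Rightarrow> real \<Rightarrow> real \<Rightarrow> real mat \<Rightarrow> real mat \<Rightarrow> real mat" where
  "P_VBP n \<alpha> \<gamma> W T =
     four_block_mat (T + \<alpha> \<cdot>\<^sub>m 1\<^sub>m n) (- (\<gamma> \<cdot>\<^sub>m W)) (0\<^sub>m n n) (1\<^sub>m n)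
     * four_block_mat (1\<^sub>m n) (0\<^sub>m n n) W T"

lemma P_VBP_expanded:
  assumes "W \<in> carrier_mat n n" "T \<in> carrier_mat n n"
  shows "P_VBP n \<alpha> \<gamma> W T =
     four_block_mat (T + \<alpha> \<cdot>\<^sub>m 1\<^sub>m n - \<gamma> \<cdot>\<^sub>m (W * W)) (- (\<gamma> \<cdot>\<^sub>m (W * T))) W T"
proof -
  have 1: "- (\<gamma> \<cdot>\<^sub>m W) * M = - (\<gamma> \<cdot>\<^sub>m (W * M))" if "M \<in> carrier_mat n n" for M
    using that assms by (simp add: mult_smult_assoc_mat[of W n n M n])
  have 2: "T + \<alpha> \<cdot>\<^sub>m 1\<^sub>m n + - (\<gamma> \<cdot>\<^sub>m (W * W)) = T + \<alpha> \<cdot>\<^sub>m 1\<^sub>m n - \<gamma> \<cdot>\<^sub>m (W * W)"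
    using assms by (intro eq_matI) auto
  have 3: "(T + \<alpha> \<cdot>\<^sub>m 1\<^sub>m n) * 0\<^sub>m n n = 0\<^sub>m n n" "(T + \<alpha> \<cdot>\<^sub>m 1\<^sub>m n) * 1\<^sub>m n = T + \<alpha> \<cdot>\<^sub>m 1\<^sub>m n"
    using assms by auto
  show ?thesis
    unfolding P_VBP_def using assms
    by (subst mult_four_block_mat[of _ n n _ n _ n _ _ n _ n]) (auto simp: 1 2 3)
qed

text \<open>The complex eigenvalues of a square real matrix, repeated according to their
  algebraic multiplicity.\<close>

definition eigvals_mset :: "real mat \<Rightarrow> complex multiset" where
  "eigvals_mset M = proots (char_poly (cmat M))"

end

theory Submission
  imports Defs
begin

text \<open>
  Put \<open>B = T + \<alpha>I\<close> and \<open>S = T + W T\<inverse> W\<close>, the Schur complement of the lower right block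
  of \<open>\<A>\<close>. The matrix \<open>\<P>\<close> is defined as a product \<open>U L\<close> with \<open>U\<close> block upper triangular and
  \<open>L = [I, 0; W, T]\<close>, and block elimination shows that \<open>\<A>\<close> has the same right factor:
  \<open>\<A> = V L\<close> with \<open>V = [S, - W T\<inverse>; 0, I]\<close>. Hence \<open>\<P>\<inverse>\<A> = L\<inverse> (U\<inverse> V) L\<close> is similar to a
  block upper triangular matrix with diagonal blocks \<open>B\<inverse> S\<close> and \<open>I\<close>, so its characteristic
  polynomial is \<open>(X - 1)\<^sup>n\<close> times that of \<open>B\<inverse> S\<close> (\<open>char_poly_preconditioned\<close>).

  The remaining \<open>n\<close> eigenvalues therefore solve \<open>S v = z B v\<close> with \<open>S\<close> symmetric and \<open>B\<close>
  symmetric positive definite, and \<open>z = v\<^sup>* S v / v\<^sup>* B v\<close> is a quotient of two real numbers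
  (\<open>symmetric_pencil_eigenvalue\<close>). For a unit vector \<open>x\<close> the form of \<open>B\<close> lies between
  \<open>\<alpha> + lambda_min T\<close> and \<open>\<alpha> + lambda_max T\<close>. The form of \<open>S\<close> is the sum of that of \<open>T\<close> and of
  \<open>(W x)\<^sup>T T\<inverse> (W x)\<close>, which is squeezed by the extreme eigenvalues of \<open>T\<inverse>\<close> and the extreme
  singular values of \<open>W\<close>; bounding numerator and denominator separately gives the interval
  (\<open>schur_complement_pencil_bounds\<close>).

  All these estimates rest on Rayleigh's principle for a real symmetric matrix \<open>A\<close>, which is
  obtained by an order argument instead of diagonalisation or compactness: let \<open>\<mu>\<close> be the
  supremum of all \<open>t\<close> for which \<open>A - tI\<close> is positive semidefinite. If \<open>\<mu>\<close> were not an
  eigenvalue, then \<open>A - \<mu>I\<close> would be invertible and positive semidefinite, hence bounded below by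
  some \<open>\<epsilon>I\<close> with \<open>\<epsilon> > 0\<close>, and \<open>\<mu> + \<epsilon>\<close> would beat the supremum
  (\<open>symmetric_mat_least_eigenvalue\<close>).
\<close>

section \<open>Inverses and symmetric bilinear forms\<close>

lemma mat_inv_inverse:
  fixes A :: "'a :: field mat"
  assumes A: "A \<in> carrier_mat n n" and det: "det A \<noteq> 0"
  shows "mat_inv A \<in> carrier_mat n n" "A * mat_inv A = 1\<^sub>m n" "mat_inv A * A = 1\<^sub>m n"
proof -
  obtain B where "mat_inverse A = Some B"
    using mat_inverse(1)[OF A] det_non_zero_imp_unit[OF A det] by fastforce
  then have "mat_inv A = B" and "A * B = 1\<^sub>m n \<and> B * A = 1\<^sub>m n \<and> B \<in> carrier_mat n n"
    using mat_inverse(2)[OF A] unfolding mat_inv_def by auto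
  then show "mat_inv A \<in> carrier_mat n n" "A * mat_inv A = 1\<^sub>m n" "mat_inv A * A = 1\<^sub>m n"
    by auto
qed

lemma mat_inv_mult_vec:
  fixes A :: "'a :: field mat"
  assumes A: "A \<in> carrier_mat n n" and det: "det A \<noteq> 0" and v: "v \<in> carrier_vec n"
  shows "A *\<^sub>v (mat_inv A *\<^sub>v v) = v" "mat_inv A *\<^sub>v (A *\<^sub>v v) = v"
  using mat_inv_inverse[OF A det] assoc_mult_mat_vec[OF A _ v] assoc_mult_mat_vec[OF _ A v] v
  by (metis one_mult_mat_vec)+

lemma symmetric_mat_scalar_prod:
  fixes A :: "real mat"
  assumes "A \<in> carrier_mat n n" "symmetric_mat A" "x \<in> carrier_vec n" "y \<in> carrier_vec n"
  shows "(A *\<^sub>v x) \<bullet> y = x \<bullet> (A *\<^sub>v y)"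
  using transpose_vec_mult_scalar[of A n n y x] assms
    comm_scalar_prod[of "A *\<^sub>v x" n y] comm_scalar_prod[of x n "A *\<^sub>v y"]
  unfolding symmetric_mat_def by auto

lemma pos_def_mat_det_nonzero:
  assumes A: "A \<in> carrier_mat n n" and "pos_def_mat A"
  shows "det A \<noteq> 0"
  using assms unfolding det_0_iff_vec_prod_zero[OF A] pos_def_mat_def by force

lemma real_scalar_prod_self:
  fixes x :: "real vec"
  assumes "x \<in> carrier_vec n"
  shows "0 \<le> x \<bullet> x" "x \<noteq> 0\<^sub>v n \<Longrightarrow> 0 < x \<bullet> x"
  using conjugate_square_ge_0_vec[of x] conjugate_square_greater_0_vec[OF assms] by auto

section \<open>Rayleigh bounds for real symmetric matrices\<close>

lemma quadratic_form_bounded: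
  fixes A :: "real mat"
  assumes A: "A \<in> carrier_mat n n"
  obtains K where "0 < K" "\<And>x. x \<in> carrier_vec n \<Longrightarrow> \<bar>x \<bullet> (A *\<^sub>v x)\<bar> \<le> K * (x \<bullet> x)"
proof -
  \<comment> \<open>The summand \<open>1\<close> keeps \<open>K\<close> positive for the zero matrix, so that it can be divided by.\<close>
  define K where "K = (\<Sum>i<n. \<Sum>j<n. \<bar>A $$ (i, j)\<bar>) + 1"
  have "\<bar>x \<bullet> (A *\<^sub>v x)\<bar> \<le> K * (x \<bullet> x)" if x: "x \<in> carrier_vec n" for x
  proof -
    have sq: "(x $ i)\<^sup>2 \<le> x \<bullet> x" if "i < n" for i
    proof -
      have "x \<bullet> x = (\<Sum>i\<in>{0..<n}. (x $ i)\<^sup>2)"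
        using x by (auto simp: scalar_prod_def power2_eq_square)
      with member_le_sum[of i "{0..<n}" "\<lambda>i. (x $ i)\<^sup>2"] that show ?thesis by auto
    qed
    have entry: "\<bar>x $ i * (A $$ (i, j) * x $ j)\<bar> \<le> \<bar>A $$ (i, j)\<bar> * (x \<bullet> x)"
      if "i < n" "j < n" for i j
    proof -
      have "\<bar>x $ i\<bar> * \<bar>x $ j\<bar> \<le> ((x $ i)\<^sup>2 + (x $ j)\<^sup>2) / 2"
        using sum_squares_bound[of "\<bar>x $ i\<bar>" "\<bar>x $ j\<bar>"] by (simp add: power2_abs)
      also have "\<dots> \<le> x \<bullet> x" using sq[OF that(1)] sq[OF that(2)] by simp
      finally have "\<bar>A $$ (i, j)\<bar> * (\<bar>x $ i\<bar> * \<bar>x $ j\<bar>) \<le> \<bar>A $$ (i, j)\<bar> * (x \<bullet> x)"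
        by (rule mult_left_mono) simp
      then show ?thesis by (simp add: abs_mult mult.left_commute)
    qed
    have "x \<bullet> (A *\<^sub>v x) = (\<Sum>i<n. \<Sum>j<n. x $ i * (A $$ (i, j) * x $ j))"
      using A x by (auto simp: scalar_prod_def mult_mat_vec_def sum_distrib_left row_def
          lessThan_atLeast0 intro!: sum.cong)
    also have "\<bar>\<dots>\<bar> \<le> (\<Sum>i<n. \<Sum>j<n. \<bar>x $ i * (A $$ (i, j) * x $ j)\<bar>)"
      by (intro order_trans[OF sum_abs] sum_mono) auto
    also have "\<dots> \<le> (\<Sum>i<n. \<Sum>j<n. \<bar>A $$ (i, j)\<bar> * (x \<bullet> x))"
      by (intro sum_mono entry) auto
    also have "\<dots> \<le> K * (x \<bullet> x)"
      using real_scalar_prod_self(1)[OF x] by (simp add: K_def sum_distrib_right distrib_right)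
    finally show ?thesis .
  qed
  moreover have "0 < K" unfolding K_def by (simp add: add_nonneg_pos sum_nonneg)
  ultimately show ?thesis using that by blast
qed

text \<open>If \<open>B y = x\<close>, then expanding \<open>0 \<le> (x + s y)\<^sup>T B (x + s y)\<close> yields
  \<open>0 \<le> x\<^sup>T B x + 2 s x\<^sup>T x + s\<^sup>2 x\<^sup>T y\<close>, and \<open>x\<^sup>T y = x\<^sup>T B\<inverse> x \<le> K x\<^sup>T x\<close>
  since every quadratic form is bounded. The choice \<open>s = - 1 / K\<close> optimises the result and gives
  the constant \<open>1 / K\<close>.\<close>
lemma psd_invertible_imp_coercive:
  fixes B :: "real mat"
  assumes B: "B \<in> carrier_mat n n" "symmetric_mat B" and det: "det B \<noteq> 0"
    and psd: "\<And>x. x \<in> carrier_vec n \<Longrightarrow> 0 \<le> x \<bullet> (B *\<^sub>v x)"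
  obtains \<epsilon> where "0 < \<epsilon>" "\<And>x. x \<in> carrier_vec n \<Longrightarrow> \<epsilon> * (x \<bullet> x) \<le> x \<bullet> (B *\<^sub>v x)"
proof -
  let ?C = "mat_inv B"
  have C: "?C \<in> carrier_mat n n" by (rule mat_inv_inverse[OF B(1) det])
  obtain K where K: "0 < K" "\<And>x. x \<in> carrier_vec n \<Longrightarrow> \<bar>x \<bullet> (?C *\<^sub>v x)\<bar> \<le> K * (x \<bullet> x)"
    using quadratic_form_bounded[OF C] by blast
  have "1 / K * (x \<bullet> x) \<le> x \<bullet> (B *\<^sub>v x)" if x: "x \<in> carrier_vec n" for x
  proof -
    define y where "y = ?C *\<^sub>v x"
    define s where "s = - 1 / K"
    have y: "y \<in> carrier_vec n" using C x unfolding y_def by simp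
    have By: "B *\<^sub>v y = x" unfolding y_def by (rule mat_inv_mult_vec[OF B(1) det x])
    have carr: "B *\<^sub>v x \<in> carrier_vec n" "s \<cdot>\<^sub>v y \<in> carrier_vec n" "s \<cdot>\<^sub>v x \<in> carrier_vec n"
      using B x y by auto
    have "0 \<le> (x + s \<cdot>\<^sub>v y) \<bullet> (B *\<^sub>v (x + s \<cdot>\<^sub>v y))"
      using psd x y by auto
    also have "B *\<^sub>v (x + s \<cdot>\<^sub>v y) = B *\<^sub>v x + s \<cdot>\<^sub>v x"
      using mult_add_distrib_mat_vec[OF B(1) x carr(2)] mult_mat_vec[OF B(1) y] By by simp
    also have "(x + s \<cdot>\<^sub>v y) \<bullet> (B *\<^sub>v x + s \<cdot>\<^sub>v x)
        = x \<bullet> (B *\<^sub>v x) + s * (x \<bullet> x) + s * (y \<bullet> (B *\<^sub>v x)) + s * s * (y \<bullet> x)"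
      using x y carr by (simp add: add_scalar_prod_distrib[of _ n] scalar_prod_add_distrib[of _ n] algebra_simps)
    also have "y \<bullet> (B *\<^sub>v x) = x \<bullet> x"
      using symmetric_mat_scalar_prod[OF B y x] By by simp
    also have "y \<bullet> x = x \<bullet> y" by (rule comm_scalar_prod[OF y x])
    finally have "0 \<le> x \<bullet> (B *\<^sub>v x) + 2 * s * (x \<bullet> x) + s * s * (x \<bullet> y)" by simp
    moreover have "s * s * (x \<bullet> y) \<le> s * s * (K * (x \<bullet> x))"
      using K(2)[OF x] unfolding y_def by (intro mult_left_mono) auto
    moreover have "2 * s * (x \<bullet> x) + s * s * (K * (x \<bullet> x)) = - (1 / K * (x \<bullet> x))"
      using K(1) unfolding s_def by (simp add: field_simps)
    ultimately show ?thesis by linarith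
  qed
  with K(1) that[of "1 / K"] show ?thesis by simp
qed

lemma scalar_prod_char_matrix:
  fixes A :: "real mat"
  assumes A: "A \<in> carrier_mat n n" and x: "x \<in> carrier_vec n"
  shows "x \<bullet> (char_matrix A t *\<^sub>v x) = x \<bullet> (A *\<^sub>v x) - t * (x \<bullet> x)"
proof -
  have "((- t) \<cdot>\<^sub>m 1\<^sub>m n) *\<^sub>v x = (- t) \<cdot>\<^sub>v x"
    using x by (intro eq_vecI) auto
  then have "char_matrix A t *\<^sub>v x = A *\<^sub>v x + (- t) \<cdot>\<^sub>v x"
    unfolding char_matrix_def using A x
    by (subst add_mult_distrib_mat_vec[of _ n n]) auto
  then show ?thesis using A x by (simp add: scalar_prod_add_distrib[of _ n])
qed

text \<open>The eigenvalue is the largest \<open>t\<close> for which \<open>A - tI\<close> is positive semidefinite. No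
  eigenvalue is presupposed, so the existence of a real eigenvalue is part of the result.\<close>
lemma symmetric_mat_least_eigenvalue:
  fixes A :: "real mat"
  assumes A: "A \<in> carrier_mat n n" "symmetric_mat A" and n: "0 < n"
  obtains \<mu> where "eigenvalue A \<mu>" "\<And>x. x \<in> carrier_vec n \<Longrightarrow> \<mu> * (x \<bullet> x) \<le> x \<bullet> (A *\<^sub>v x)"
proof -
  define R where "R = {t. \<forall>x \<in> carrier_vec n. t * (x \<bullet> x) \<le> x \<bullet> (A *\<^sub>v x)}"
  define \<mu> where "\<mu> = Sup R"
  obtain K where K: "\<And>x. x \<in> carrier_vec n \<Longrightarrow> \<bar>x \<bullet> (A *\<^sub>v x)\<bar> \<le> K * (x \<bullet> x)"
    using quadratic_form_bounded[OF A(1)] by blast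
  have "- K \<in> R" unfolding R_def using K by (fastforce simp: abs_le_iff)
  have quotient: "t \<le> x \<bullet> (A *\<^sub>v x) / (x \<bullet> x)"
    if "t \<in> R" "x \<in> carrier_vec n" "x \<noteq> 0\<^sub>v n" for t x
    using that real_scalar_prod_self(2)[of x n] by (auto simp: R_def field_simps)
  \<comment> \<open>Any nonzero test vector bounds \<open>R\<close> from above; one exists because \<open>n > 0\<close>.\<close>
  have "bdd_above R"
    using quotient[of _ "unit_vec n 0"] n unit_vec_nonzero[of 0 n] by (intro bdd_aboveI) auto
  have "\<mu> \<in> R" unfolding R_def
  proof (clarify)
    fix x :: "real vec" assume x: "x \<in> carrier_vec n"
    show "\<mu> * (x \<bullet> x) \<le> x \<bullet> (A *\<^sub>v x)"
    proof (cases "x = 0\<^sub>v n")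
      case True
      then show ?thesis using A by simp
    next
      case False
      have "\<mu> \<le> x \<bullet> (A *\<^sub>v x) / (x \<bullet> x)"
        unfolding \<mu>_def using \<open>- K \<in> R\<close> quotient[OF _ x False] by (intro cSup_least) auto
      with real_scalar_prod_self(2)[OF x False] show ?thesis by (simp add: field_simps)
    qed
  qed
  let ?B = "char_matrix A \<mu>"
  have "eigenvalue A \<mu>"
  proof (rule ccontr)
    assume "\<not> eigenvalue A \<mu>"
    then have "det ?B \<noteq> 0" using eigenvalue_det[OF A(1)] by simp
    moreover have "symmetric_mat ?B"
      using A unfolding symmetric_mat_def char_matrix_def
      by (subst transpose_add[of _ n n]) auto
    moreover have "0 \<le> x \<bullet> (?B *\<^sub>v x)" if "x \<in> carrier_vec n" for x
      using \<open>\<mu> \<in> R\<close> that scalar_prod_char_matrix[OF A(1) that] unfolding R_def by simp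
    ultimately obtain \<epsilon> where \<epsilon>: "0 < \<epsilon>"
      "\<And>x. x \<in> carrier_vec n \<Longrightarrow> \<epsilon> * (x \<bullet> x) \<le> x \<bullet> (?B *\<^sub>v x)"
      using psd_invertible_imp_coercive[of ?B n] A(1) by auto
    have "\<mu> + \<epsilon> \<in> R"
      unfolding R_def using \<epsilon>(2) scalar_prod_char_matrix[OF A(1)]
      by (auto simp: algebra_simps)
    then have "\<mu> + \<epsilon> \<le> \<mu>"
      unfolding \<mu>_def using \<open>bdd_above R\<close> by (rule cSup_upper)
    with \<epsilon>(1) show False by simp
  qed
  with \<open>\<mu> \<in> R\<close> that show ?thesis unfolding R_def by auto
qed

lemma symmetric_mat_greatest_eigenvalue:
  fixes A :: "real mat"
  assumes A: "A \<in> carrier_mat n n" "symmetric_mat A" and n: "0 < n"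
  obtains \<mu> where "eigenvalue A \<mu>" "\<And>x. x \<in> carrier_vec n \<Longrightarrow> x \<bullet> (A *\<^sub>v x) \<le> \<mu> * (x \<bullet> x)"
proof -
  have "- A \<in> carrier_mat n n" "symmetric_mat (- A)"
    using A unfolding symmetric_mat_def by (auto simp: transpose_uminus)
  then obtain \<mu> where \<mu>: "eigenvalue (- A) \<mu>"
    "\<And>x. x \<in> carrier_vec n \<Longrightarrow> \<mu> * (x \<bullet> x) \<le> x \<bullet> (- A *\<^sub>v x)"
    using symmetric_mat_least_eigenvalue n by blast
  from \<mu>(1) obtain v where v: "v \<in> carrier_vec n" "v \<noteq> 0\<^sub>v n" "- (A *\<^sub>v v) = \<mu> \<cdot>\<^sub>v v"
    using A unfolding eigenvalue_def eigenvector_def by auto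
  have "A *\<^sub>v v = - (- (A *\<^sub>v v))" by simp
  also have "\<dots> = (- \<mu>) \<cdot>\<^sub>v v" unfolding v(3) by (auto intro!: eq_vecI)
  finally have "eigenvalue A (- \<mu>)"
    using A v unfolding eigenvalue_def eigenvector_def by auto
  moreover have "x \<bullet> (A *\<^sub>v x) \<le> - \<mu> * (x \<bullet> x)" if "x \<in> carrier_vec n" for x
    using \<mu>(2)[OF that] that A by auto
  ultimately show ?thesis using that by blast
qed

lemma rayleigh_bounds:
  fixes A :: "real mat"
  assumes A: "A \<in> carrier_mat n n" "symmetric_mat A" and n: "0 < n"
    and ev: "\<And>k. eigenvalue A k \<Longrightarrow> l \<le> k \<and> k \<le> u" and x: "x \<in> carrier_vec n"
  shows "l * (x \<bullet> x) \<le> x \<bullet> (A *\<^sub>v x)" "x \<bullet> (A *\<^sub>v x) \<le> u * (x \<bullet> x)"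
proof -
  obtain \<mu> where "eigenvalue A \<mu>" "\<mu> * (x \<bullet> x) \<le> x \<bullet> (A *\<^sub>v x)"
    using symmetric_mat_least_eigenvalue[OF A n] x by blast
  with ev[of \<mu>] mult_right_mono[OF _ real_scalar_prod_self(1)[OF x], of l \<mu>]
  show "l * (x \<bullet> x) \<le> x \<bullet> (A *\<^sub>v x)" by linarith
  obtain \<nu> where "eigenvalue A \<nu>" "x \<bullet> (A *\<^sub>v x) \<le> \<nu> * (x \<bullet> x)"
    using symmetric_mat_greatest_eigenvalue[OF A n] x by blast
  with ev[of \<nu>] mult_right_mono[OF _ real_scalar_prod_self(1)[OF x], of \<nu> u]
  show "x \<bullet> (A *\<^sub>v x) \<le> u * (x \<bullet> x)" by linarith
qed

section \<open>Extreme eigenvalues and singular values\<close>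

lemma eigenvalue_lambda_bounds:
  assumes "A \<in> carrier_mat n n" "eigenvalue A k"
  shows "lambda_min A \<le> k" "k \<le> lambda_max A"
  using assms card_finite_spectrum(1)[of A n]
  unfolding lambda_min_def lambda_max_def spectrum_def by auto

lemma pos_def_mat_eigenvalue_pos:
  assumes A: "A \<in> carrier_mat n n" "pos_def_mat A" and k: "eigenvalue A k"
  shows "0 < k"
proof -
  obtain v where v: "v \<in> carrier_vec n" "v \<noteq> 0\<^sub>v n" "A *\<^sub>v v = k \<cdot>\<^sub>v v"
    using k A unfolding eigenvalue_def eigenvector_def by auto
  have "0 < v \<bullet> (A *\<^sub>v v)" using A v unfolding pos_def_mat_def by auto
  with v real_scalar_prod_self(1)[OF v(1)] show ?thesis by (simp add: zero_less_mult_iff)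
qed

lemma pos_def_mat_lambda_min_pos:
  assumes A: "A \<in> carrier_mat n n" "symmetric_mat A" "pos_def_mat A" and n: "0 < n"
  shows "0 < lambda_min A"
proof -
  have "spectrum A \<noteq> {}"
    using symmetric_mat_least_eigenvalue[OF A(1,2) n] unfolding spectrum_def by blast
  then have "eigenvalue A (lambda_min A)"
    using Min_in[OF card_finite_spectrum(1)[OF A(1)]] unfolding lambda_min_def spectrum_def by blast
  then show ?thesis using pos_def_mat_eigenvalue_pos A by blast
qed

lemma symmetric_mat_inv:
  fixes A :: "real mat"
  assumes A: "A \<in> carrier_mat n n" "symmetric_mat A" and det: "det A \<noteq> 0"
  shows "symmetric_mat (mat_inv A)"
proof -
  let ?C = "mat_inv A"
  note inv = mat_inv_inverse[OF A(1) det]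
  have "transpose_mat ?C * A = 1\<^sub>m n"
    using transpose_mult[OF A(1) inv(1)] inv(2) A(2) unfolding symmetric_mat_def by simp
  then have "transpose_mat ?C * A * ?C = ?C" using inv(1) by simp
  moreover have "transpose_mat ?C * A * ?C = transpose_mat ?C"
    using assoc_mult_mat[of "transpose_mat ?C" n n A n ?C n] A(1) inv by simp
  ultimately show ?thesis unfolding symmetric_mat_def by simp
qed

text \<open>The eigenvalues of the inverse are the reciprocals of those of \<open>A\<close>, so the roles of the
  least and the greatest eigenvalue are exchanged.\<close>
lemma rayleigh_bounds_mat_inv:
  assumes A: "A \<in> carrier_mat n n" "symmetric_mat A" "pos_def_mat A"
    and n: "0 < n" and x: "x \<in> carrier_vec n"
  shows "1 / lambda_max A * (x \<bullet> x) \<le> x \<bullet> (mat_inv A *\<^sub>v x)"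
    "x \<bullet> (mat_inv A *\<^sub>v x) \<le> 1 / lambda_min A * (x \<bullet> x)"
proof -
  have det: "det A \<noteq> 0" using A pos_def_mat_det_nonzero by blast
  note inv = mat_inv_inverse[OF A(1) det]
  have ev: "1 / lambda_max A \<le> k \<and> k \<le> 1 / lambda_min A" if k: "eigenvalue (mat_inv A) k" for k
  proof -
    obtain v where v: "v \<in> carrier_vec n" "v \<noteq> 0\<^sub>v n" "mat_inv A *\<^sub>v v = k \<cdot>\<^sub>v v"
      using k inv unfolding eigenvalue_def eigenvector_def by auto
    have "v = A *\<^sub>v (k \<cdot>\<^sub>v v)"
      using mat_inv_mult_vec(1)[OF A(1) det v(1)] v(3) by simp
    also have "\<dots> = k \<cdot>\<^sub>v (A *\<^sub>v v)" by (rule mult_mat_vec[OF A(1) v(1)])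
    finally have kv: "v = k \<cdot>\<^sub>v (A *\<^sub>v v)" .
    have "0 \<cdot>\<^sub>v (A *\<^sub>v v) = 0\<^sub>v n" using A v by (intro eq_vecI) auto
    with kv v(2) have "k \<noteq> 0" by metis
    then have "A *\<^sub>v v = (1 / k) \<cdot>\<^sub>v v"
      by (subst (2) kv) (simp add: smult_smult_assoc)
    then have "eigenvalue A (1 / k)"
      using v A unfolding eigenvalue_def eigenvector_def by auto
    note bounds = eigenvalue_lambda_bounds[OF A(1) this] pos_def_mat_eigenvalue_pos[OF A(1,3) this]
    have "0 < lambda_min A" by (rule pos_def_mat_lambda_min_pos[OF A n])
    moreover have "0 < lambda_max A" using bounds(2,3) by (rule less_le_trans[rotated])
    moreover have "0 < k" using bounds(3) by simp
    moreover have "1 \<le> k * lambda_max A" "k * lambda_min A \<le> 1"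
      using bounds \<open>0 < k\<close> by (simp_all add: field_simps)
    ultimately show ?thesis by (simp add: pos_divide_le_eq pos_le_divide_eq)
  qed
  show "1 / lambda_max A * (x \<bullet> x) \<le> x \<bullet> (mat_inv A *\<^sub>v x)"
    "x \<bullet> (mat_inv A *\<^sub>v x) \<le> 1 / lambda_min A * (x \<bullet> x)"
    using rayleigh_bounds[OF inv(1) symmetric_mat_inv[OF A(1,2) det] n ev x] by auto
qed

text \<open>These are the Rayleigh bounds of the Gram matrix \<open>W\<^sup>T W\<close>, whose quadratic form is
  \<open>\<parallel>W x\<parallel>\<^sup>2\<close>; its eigenvalues are nonnegative, so squaring undoes the square root.\<close>
lemma sigma_bounds:
  assumes W: "W \<in> carrier_mat n n" and n: "0 < n" and x: "x \<in> carrier_vec n"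
  shows "(sigma_min W)\<^sup>2 * (x \<bullet> x) \<le> (W *\<^sub>v x) \<bullet> (W *\<^sub>v x)"
    "(W *\<^sub>v x) \<bullet> (W *\<^sub>v x) \<le> (sigma_max W)\<^sup>2 * (x \<bullet> x)"
proof -
  let ?G = "transpose_mat W * W"
  have G: "?G \<in> carrier_mat n n" "symmetric_mat ?G"
    using W unfolding symmetric_mat_def by (auto simp: transpose_mult[of _ n n _ n])
  have quad: "y \<bullet> (?G *\<^sub>v y) = (W *\<^sub>v y) \<bullet> (W *\<^sub>v y)" if y: "y \<in> carrier_vec n" for y
    using transpose_vec_mult_scalar[OF W y, of "W *\<^sub>v y"] W y
      comm_scalar_prod[of y n "?G *\<^sub>v y"] by simp
  have nonneg: "0 \<le> k" if "eigenvalue ?G k" for k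
  proof -
    obtain v where v: "v \<in> carrier_vec n" "v \<noteq> 0\<^sub>v n" "?G *\<^sub>v v = k \<cdot>\<^sub>v v"
      using \<open>eigenvalue ?G k\<close> G unfolding eigenvalue_def eigenvector_def by auto
    have "0 \<le> k * (v \<bullet> v)"
      using quad[OF v(1)] v real_scalar_prod_self(1)[of "W *\<^sub>v v" n] W by simp
    with real_scalar_prod_self(2)[OF v(1,2)] show ?thesis by (simp add: zero_le_mult_iff)
  qed
  have fin: "finite (singular_values W)"
    using card_finite_spectrum(1)[OF G(1)] unfolding singular_values_def by simp
  have "spectrum ?G \<noteq> {}"
    using symmetric_mat_least_eigenvalue[OF G n] unfolding spectrum_def by blast
  then have "sigma_min W \<in> singular_values W"
    using Min_in[OF fin] unfolding sigma_min_def singular_values_def by simp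
  then have "0 \<le> sigma_min W"
    using nonneg unfolding singular_values_def spectrum_def by auto
  have ev: "(sigma_min W)\<^sup>2 \<le> k \<and> k \<le> (sigma_max W)\<^sup>2" if k: "eigenvalue ?G k" for k
  proof -
    have "sqrt k \<in> singular_values W"
      using k unfolding singular_values_def spectrum_def by simp
    then have "sigma_min W \<le> sqrt k" "sqrt k \<le> sigma_max W"
      using fin unfolding sigma_min_def sigma_max_def by auto
    with power_mono[of "sigma_min W" "sqrt k" 2] power_mono[of "sqrt k" "sigma_max W" 2]
    show ?thesis using \<open>0 \<le> sigma_min W\<close> nonneg[OF k] by simp
  qed
  show "(sigma_min W)\<^sup>2 * (x \<bullet> x) \<le> (W *\<^sub>v x) \<bullet> (W *\<^sub>v x)"
    "(W *\<^sub>v x) \<bullet> (W *\<^sub>v x) \<le> (sigma_max W)\<^sup>2 * (x \<bullet> x)"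
    using rayleigh_bounds[OF G n ev x] quad[OF x] by auto
qed

section \<open>Complex eigenvalues of symmetric definite pencils\<close>

text \<open>The cross terms between real and imaginary part cancel by symmetry. This transfers
  inequalities known on real vectors to complex eigenvectors.\<close>
lemma quad_form_cmat_symmetric:
  assumes A: "A \<in> carrier_mat n n" "symmetric_mat A" and v: "v \<in> carrier_vec n"
  defines "a \<equiv> map_vec Re v" and "b \<equiv> map_vec Im v"
  shows "quad_form (cmat A) v = complex_of_real (a \<bullet> (A *\<^sub>v a) + b \<bullet> (A *\<^sub>v b))"
proof -
  have carr: "a \<in> carrier_vec n" "b \<in> carrier_vec n" "A *\<^sub>v a \<in> carrier_vec n" "A *\<^sub>v b \<in> carrier_vec n"
    using A v unfolding a_def b_def by auto
  have prod: "(cmat A *\<^sub>v v) $ i = Complex ((A *\<^sub>v a) $ i) ((A *\<^sub>v b) $ i)" if "i < n" for i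
    using that A v unfolding a_def b_def
    by (intro complex_eqI) (auto simp: scalar_prod_def)
  have quad: "quad_form (cmat A) v
      = (\<Sum>i\<in>{0..<n}. Complex ((A *\<^sub>v a) $ i) ((A *\<^sub>v b) $ i) * cnj (v $ i))"
    unfolding quad_form_def using v prod by (auto simp: scalar_prod_def intro!: sum.cong)
  have "Re (quad_form (cmat A) v) = (A *\<^sub>v a) \<bullet> a + (A *\<^sub>v b) \<bullet> b"
    unfolding quad using v carr by (auto simp: scalar_prod_def a_def b_def sum.distrib)
  moreover have "Im (quad_form (cmat A) v) = (A *\<^sub>v b) \<bullet> a - (A *\<^sub>v a) \<bullet> b"
    unfolding quad using v carr by (auto simp: scalar_prod_def a_def b_def sum_subtractf sum.distrib sum_negf)
  moreover have "(A *\<^sub>v b) \<bullet> a = (A *\<^sub>v a) \<bullet> b"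
    using symmetric_mat_scalar_prod[OF A] comm_scalar_prod carr by metis
  ultimately show ?thesis
    using symmetric_mat_scalar_prod[OF A] carr by (intro complex_eqI) auto
qed

text \<open>From \<open>A v = z B v\<close> it follows that \<open>v\<^sup>* A v = z v\<^sup>* B v\<close>, where both forms are real and the
  second one is positive. The inequalities between the two forms on real vectors, applied to the
  real and the imaginary part of \<open>v\<close>, enclose the quotient.\<close>
lemma symmetric_pencil_eigenvalue:
  fixes A B :: "real mat"
  assumes A: "A \<in> carrier_mat n n" "symmetric_mat A"
    and B: "B \<in> carrier_mat n n" "symmetric_mat B" "pos_def_mat B"
    and bounds: "\<And>x. x \<in> carrier_vec n \<Longrightarrow>
      l * (x \<bullet> (B *\<^sub>v x)) \<le> x \<bullet> (A *\<^sub>v x) \<and> x \<bullet> (A *\<^sub>v x) \<le> u * (x \<bullet> (B *\<^sub>v x))"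
    and z: "eigenvalue (cmat (mat_inv B * A)) z"
  shows "z \<in> \<real> \<and> Re z \<in> {l..u}"
proof -
  have det: "det B \<noteq> 0" using B pos_def_mat_det_nonzero by blast
  note inv = mat_inv_inverse[OF B(1) det]
  obtain v where v: "v \<in> carrier_vec n" "v \<noteq> 0\<^sub>v n"
    and ev: "cmat (mat_inv B * A) *\<^sub>v v = z \<cdot>\<^sub>v v"
    using z inv(1) A(1) unfolding eigenvalue_def eigenvector_def by auto
  have "B * (mat_inv B * A) = A"
    using assoc_mult_mat[OF B(1) inv(1) A(1)] inv(2) A(1) by simp
  then have "cmat A = cmat B * cmat (mat_inv B * A)"
    using of_real_hom.mat_hom_mult[OF B(1), of "mat_inv B * A" n] inv(1) A(1) by simp
  then have "cmat A *\<^sub>v v = cmat B *\<^sub>v (z \<cdot>\<^sub>v v)"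
    using assoc_mult_mat_vec[of "cmat B" n n "cmat (mat_inv B * A)" n v] A B inv v ev by simp
  also have "\<dots> = z \<cdot>\<^sub>v (cmat B *\<^sub>v v)"
    using B v by (intro mult_mat_vec) auto
  finally have pencil: "quad_form (cmat A) v = z * quad_form (cmat B) v"
    unfolding quad_form_def using B v by simp
  define a b where "a = map_vec Re v" and "b = map_vec Im v"
  have ab: "a \<in> carrier_vec n" "b \<in> carrier_vec n" using v unfolding a_def b_def by auto
  define p q where "p = a \<bullet> (A *\<^sub>v a) + b \<bullet> (A *\<^sub>v b)" and "q = a \<bullet> (B *\<^sub>v a) + b \<bullet> (B *\<^sub>v b)"
  have "complex_of_real p = z * complex_of_real q"
    using pencil quad_form_cmat_symmetric[OF A v(1)] quad_form_cmat_symmetric[OF B(1,2) v(1)]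
    unfolding p_def q_def a_def b_def by simp
  moreover have "0 < q"
  proof -
    have pos: "0 < x \<bullet> (B *\<^sub>v x)" if "x \<in> carrier_vec n" "x \<noteq> 0\<^sub>v n" for x
      using B that unfolding pos_def_mat_def by auto
    have zero: "x \<bullet> (B *\<^sub>v x) = 0" if "x = 0\<^sub>v n" for x
      using B that by simp
    have "a \<noteq> 0\<^sub>v n \<or> b \<noteq> 0\<^sub>v n"
    proof (rule ccontr)
      assume "\<not> ?thesis"
      then have "Re (v $ i) = 0" "Im (v $ i) = 0" if "i < n" for i
        using v that unfolding a_def b_def
        by (metis carrier_vecD index_map_vec(1) index_zero_vec(1))+
      then have "v = 0\<^sub>v n" using v by (intro eq_vecI) (auto intro: complex_eqI)
      with v show False by simp
    qed
    then show ?thesis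
      unfolding q_def using pos[OF ab(1)] pos[OF ab(2)] zero[of a] zero[of b] by argo
  qed
  ultimately have z_eq: "z = complex_of_real (p / q)" by (simp add: field_simps)
  have "l * q \<le> p" "p \<le> u * q"
    using bounds[OF ab(1)] bounds[OF ab(2)] unfolding p_def q_def by (auto simp: distrib_left)
  then show ?thesis using \<open>0 < q\<close> unfolding z_eq by (auto simp: field_simps)
qed

section \<open>The preconditioned block matrix\<close>

lemma char_poly_four_block_lower_left_zero:
  fixes A :: "'a :: idom mat"
  assumes A: "A \<in> carrier_mat n n" and B: "B \<in> carrier_mat n m" and D: "D \<in> carrier_mat m m"
  shows "char_poly (four_block_mat A B (0\<^sub>m m n) D) = char_poly A * char_poly D"
proof -
  have "char_poly_matrix (four_block_mat A B (0\<^sub>m m n) D)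
      = four_block_mat (char_poly_matrix A) (map_mat (\<lambda>a. [:- a:]) B) (0\<^sub>m m n) (char_poly_matrix D)"
    unfolding char_poly_matrix_def using A B D by (intro eq_matI) auto
  then show ?thesis
    unfolding char_poly_def using A B D by (simp add: det_four_block_mat_lower_left_zero[of _ n _ m])
qed

lemma char_poly_one_mat: "char_poly (1\<^sub>m n :: 'a :: comm_ring_1 mat) = [:-1, 1:] ^ n"
proof -
  have "diag_mat (1\<^sub>m n :: 'a mat) = replicate n 1"
    unfolding diag_mat_def by (auto intro: nth_equalityI)
  then show ?thesis
    using char_poly_upper_triangular[of "1\<^sub>m n :: 'a mat" n] by simp
qed

text \<open>The spectral problem of size \<open>2n\<close> reduces to one of size \<open>n\<close>: with \<open>\<P> = U L\<close> and
  \<open>\<A> = V L\<close>, the preconditioned matrix is \<open>L\<inverse> N L\<close>, where \<open>N = U\<inverse> V\<close> is block upper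
  triangular with lower right block \<open>I\<close>.\<close>
lemma char_poly_preconditioned:
  fixes W T :: "real mat"
  assumes W: "W \<in> carrier_mat n n" and T: "T \<in> carrier_mat n n"
    and det_T: "det T \<noteq> 0" and det_B: "det (T + \<alpha> \<cdot>\<^sub>m 1\<^sub>m n) \<noteq> 0"
  shows "det (P_VBP n \<alpha> \<gamma> W T) \<noteq> 0"
    and "char_poly (mat_inv (P_VBP n \<alpha> \<gamma> W T) * block_A W T) =
      char_poly (mat_inv (T + \<alpha> \<cdot>\<^sub>m 1\<^sub>m n) * (T + W * mat_inv T * W)) * [:-1, 1:] ^ n"
proof -
  let ?n2 = "n + n"
  define B where "B = T + \<alpha> \<cdot>\<^sub>m 1\<^sub>m n"
  define S where "S = T + W * mat_inv T * W"
  define P where "P = P_VBP n \<alpha> \<gamma> W T"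
  define A where "A = block_A W T"
  define U where "U = four_block_mat B (- (\<gamma> \<cdot>\<^sub>m W)) (0\<^sub>m n n) (1\<^sub>m n)"
  define L where "L = four_block_mat (1\<^sub>m n) (0\<^sub>m n n) W T"
  define V where "V = four_block_mat S (- (W * mat_inv T)) (0\<^sub>m n n) (1\<^sub>m n)"
  define H where "H = mat_inv B * S"
  define X where "X = mat_inv B * (\<gamma> \<cdot>\<^sub>m W - W * mat_inv T)"
  define N where "N = four_block_mat H X (0\<^sub>m n n) (1\<^sub>m n)"
  have B: "B \<in> carrier_mat n n" using T unfolding B_def by simp
  note iT = mat_inv_inverse[OF T det_T]
  note iB = mat_inv_inverse[OF B det_B[folded B_def]]
  have S: "S \<in> carrier_mat n n" using W T iT unfolding S_def by simp
  have H: "H \<in> carrier_mat n n" and X: "X \<in> carrier_mat n n"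
    using iB S W iT unfolding H_def X_def by auto
  have carr: "U \<in> carrier_mat ?n2 ?n2" "L \<in> carrier_mat ?n2 ?n2" "V \<in> carrier_mat ?n2 ?n2"
    "N \<in> carrier_mat ?n2 ?n2" "A \<in> carrier_mat ?n2 ?n2"
    using B W T S H unfolding U_def L_def V_def N_def A_def block_A_def by auto
  have P_eq: "P = U * L" unfolding P_def P_VBP_def U_def L_def B_def ..
  have P: "P \<in> carrier_mat ?n2 ?n2" unfolding P_eq using carr by simp
  have "det L = det T"
    unfolding L_def using det_four_block_mat_upper_right_zero[of "1\<^sub>m n" n _ n W T] W T by simp
  then have det_L: "det L \<noteq> 0" using det_T by simp
  have "det U = det B"
    unfolding U_def using det_four_block_mat_lower_left_zero[of B n _ n _ "1\<^sub>m n"] W B by simp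
  then have det_P: "det P \<noteq> 0"
    unfolding P_eq using det_mult[OF carr(1,2)] det_L det_B B_def by simp
  then show "det (P_VBP n \<alpha> \<gamma> W T) \<noteq> 0" unfolding P_def .
  note iL = mat_inv_inverse[OF carr(2) det_L]
  note iP = mat_inv_inverse[OF P det_P]
  have WiTT: "W * mat_inv T * T = W"
    using W T iT assoc_mult_mat[of W n n "mat_inv T" n T n] by simp
  \<comment> \<open>Block elimination: adding \<open>W T\<inverse>\<close> times the last block row of \<open>\<A>\<close> to the first one
    clears \<open>- W\<close> and turns \<open>T\<close> into \<open>S\<close>; the factor \<open>V\<close> undoes this.\<close>
  have "V * L = A"
  proof -
    have "S * 1\<^sub>m n + - (W * mat_inv T) * W = T"
      using W T iT S unfolding S_def by (intro eq_matI) auto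
    moreover have "S * 0\<^sub>m n n + - (W * mat_inv T) * T = - W"
      using W T iT S WiTT by simp
    ultimately show ?thesis
      unfolding V_def L_def A_def block_A_def using W T S iT
      by (subst mult_four_block_mat[of _ n n _ n _ n _ _ n _ n]) auto
  qed
  moreover have "U * N = V"
  proof -
    have "B * H = S" unfolding H_def
      using assoc_mult_mat[OF B iB(1) S] iB(2) S by simp
    moreover have "\<gamma> \<cdot>\<^sub>m W - W * mat_inv T \<in> carrier_mat n n"
      using W iT by (intro minus_carrier_mat) simp
    then have "B * X = \<gamma> \<cdot>\<^sub>m W - W * mat_inv T"
      unfolding X_def using assoc_mult_mat[OF B iB(1)] iB(2) by (metis left_mult_one_mat)
    moreover have "\<gamma> \<cdot>\<^sub>m W - W * mat_inv T + - (\<gamma> \<cdot>\<^sub>m W) = - (W * mat_inv T)"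
      using W iT by (intro eq_matI) auto
    ultimately show ?thesis
      unfolding U_def N_def V_def using W B S H X iT
      by (subst mult_four_block_mat[of _ n n _ n _ n _ _ n _ n]) auto
  qed
  ultimately have "A = U * N * L" by simp
  also have "\<dots> = P * (mat_inv L * N * L)"
  proof -
    have "P * (mat_inv L * N * L) = U * (L * (mat_inv L * N * L))"
      unfolding P_eq using carr iL by (simp add: assoc_mult_mat[of _ ?n2 ?n2 _ ?n2 _ ?n2])
    also have "L * (mat_inv L * N * L) = (L * mat_inv L) * (N * L)"
      using assoc_mult_mat[OF carr(2) iL(1), of "N * L" ?n2] assoc_mult_mat[OF iL(1) carr(4,2)] carr
      by simp
    also have "\<dots> = N * L" unfolding iL(2) using carr by simp
    finally show ?thesis using carr by (simp add: assoc_mult_mat[of _ ?n2 ?n2 _ ?n2 _ ?n2])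
  qed
  finally have "mat_inv P * A = mat_inv P * (P * (mat_inv L * N * L))" by simp
  also have "\<dots> = (mat_inv P * P) * (mat_inv L * N * L)"
    using P iP carr iL by (intro assoc_mult_mat[symmetric]) auto
  also have "\<dots> = mat_inv L * N * L" using iP carr iL by simp
  finally have "similar_mat_wit (mat_inv P * A) N (mat_inv L) L"
    using carr P iP iL by (intro similar_mat_witI[of _ _ ?n2]) auto
  then have "char_poly (mat_inv P * A) = char_poly N"
    by (intro char_poly_similar) (auto simp: similar_mat_def)
  also have "\<dots> = char_poly H * [:-1, 1:] ^ n"
    unfolding N_def using char_poly_four_block_lower_left_zero[OF H X] by (simp add: char_poly_one_mat)
  finally show "char_poly (mat_inv (P_VBP n \<alpha> \<gamma> W T) * block_A W T) =
      char_poly (mat_inv (T + \<alpha> \<cdot>\<^sub>m 1\<^sub>m n) * (T + W * mat_inv T * W)) * [:-1, 1:] ^ n"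
    unfolding P_def A_def H_def B_def S_def .
qed

section \<open>Localisation of the remaining eigenvalues\<close>

lemma shifted_mat_quadratic_form:
  fixes T :: "real mat"
  assumes "T \<in> carrier_mat n n" "x \<in> carrier_vec n"
  shows "x \<bullet> ((T + \<alpha> \<cdot>\<^sub>m 1\<^sub>m n) *\<^sub>v x) = x \<bullet> (T *\<^sub>v x) + \<alpha> * (x \<bullet> x)"
  using scalar_prod_char_matrix[of T n x "- \<alpha>"] assms unfolding char_matrix_def by simp

text \<open>With \<open>d = x\<^sup>T x\<close>, \<open>t = x\<^sup>T T x\<close> and \<open>w = (W x)\<^sup>T T\<inverse> (W x)\<close> the two forms are
  \<open>t + \<alpha> d\<close> and \<open>t + w\<close>. The bounds \<open>lo\<close> and \<open>hi\<close> result from estimating \<open>t\<close> in numerator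
  and denominator independently, each time by the less favourable extreme eigenvalue.\<close>
lemma schur_complement_pencil_bounds:
  fixes W T :: "real mat"
  assumes W: "W \<in> carrier_mat n n" "symmetric_mat W"
    and T: "T \<in> carrier_mat n n" "symmetric_mat T" "pos_def_mat T"
    and n: "0 < n" and \<alpha>: "0 < \<alpha>" and x: "x \<in> carrier_vec n"
  defines "lo \<equiv> (lambda_min T + (sigma_min W)\<^sup>2 / lambda_max T) / (\<alpha> + lambda_max T)"
    and "hi \<equiv> (lambda_max T + (sigma_max W)\<^sup>2 / lambda_min T) / (\<alpha> + lambda_min T)"
  shows "0 < lo"
    and "lo * (x \<bullet> ((T + \<alpha> \<cdot>\<^sub>m 1\<^sub>m n) *\<^sub>v x)) \<le> x \<bullet> ((T + W * mat_inv T * W) *\<^sub>v x)"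
    and "x \<bullet> ((T + W * mat_inv T * W) *\<^sub>v x) \<le> hi * (x \<bullet> ((T + \<alpha> \<cdot>\<^sub>m 1\<^sub>m n) *\<^sub>v x))"
proof -
  let ?m = "lambda_min T" and ?M = "lambda_max T"
  define d t w where "d = x \<bullet> x" and "t = x \<bullet> (T *\<^sub>v x)"
    and "w = (W *\<^sub>v x) \<bullet> (mat_inv T *\<^sub>v (W *\<^sub>v x))"
  have det: "det T \<noteq> 0" using T pos_def_mat_det_nonzero by blast
  note iT = mat_inv_inverse[OF T(1) det]
  have Wx: "W *\<^sub>v x \<in> carrier_vec n" using W x by simp
  have m: "0 < ?m" by (rule pos_def_mat_lambda_min_pos[OF T n])
  obtain k where "eigenvalue T k" using symmetric_mat_least_eigenvalue[OF T(1,2) n] by blast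
  then have M: "0 < ?M" using eigenvalue_lambda_bounds[OF T(1)] m by fastforce
  show "0 < lo" unfolding lo_def using m M \<alpha> by (intro divide_pos_pos add_pos_nonneg) auto
  have "0 \<le> hi" unfolding hi_def using m M \<alpha> by (intro divide_nonneg_pos add_nonneg_nonneg) auto
  have t: "?m * d \<le> t" "t \<le> ?M * d"
    using rayleigh_bounds[OF T(1,2) n _ x] eigenvalue_lambda_bounds[OF T(1)]
    unfolding t_def d_def by blast+
  have w_lo: "(sigma_min W)\<^sup>2 / ?M * d \<le> w"
  proof -
    have "(sigma_min W)\<^sup>2 / ?M * d = 1 / ?M * ((sigma_min W)\<^sup>2 * d)" by simp
    also have "\<dots> \<le> 1 / ?M * ((W *\<^sub>v x) \<bullet> (W *\<^sub>v x))"
      unfolding d_def using sigma_bounds(1)[OF W(1) n x] M by (intro mult_left_mono) auto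
    also have "\<dots> \<le> w"
      unfolding w_def by (rule rayleigh_bounds_mat_inv(1)[OF T n Wx])
    finally show ?thesis .
  qed
  have w_hi: "w \<le> (sigma_max W)\<^sup>2 / ?m * d"
  proof -
    have "w \<le> 1 / ?m * ((W *\<^sub>v x) \<bullet> (W *\<^sub>v x))"
      unfolding w_def by (rule rayleigh_bounds_mat_inv(2)[OF T n Wx])
    also have "\<dots> \<le> 1 / ?m * ((sigma_max W)\<^sup>2 * d)"
      unfolding d_def using sigma_bounds(2)[OF W(1) n x] m by (intro mult_left_mono) auto
    finally show ?thesis by simp
  qed
  have B: "x \<bullet> ((T + \<alpha> \<cdot>\<^sub>m 1\<^sub>m n) *\<^sub>v x) = t + \<alpha> * d"
    unfolding t_def d_def by (rule shifted_mat_quadratic_form[OF T(1) x])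
  have S: "x \<bullet> ((T + W * mat_inv T * W) *\<^sub>v x) = t + w"
  proof -
    have "(W * mat_inv T * W) *\<^sub>v x = (W * mat_inv T) *\<^sub>v (W *\<^sub>v x)"
      using W iT x by (intro assoc_mult_mat_vec) auto
    also have "\<dots> = W *\<^sub>v (mat_inv T *\<^sub>v (W *\<^sub>v x))"
      by (rule assoc_mult_mat_vec[OF W(1) iT(1) Wx])
    finally have "(T + W * mat_inv T * W) *\<^sub>v x = T *\<^sub>v x + W *\<^sub>v (mat_inv T *\<^sub>v (W *\<^sub>v x))"
      using add_mult_distrib_mat_vec[of T n n "W * mat_inv T * W" x] T W iT x by simp
    then have "x \<bullet> ((T + W * mat_inv T * W) *\<^sub>v x)
        = t + x \<bullet> (W *\<^sub>v (mat_inv T *\<^sub>v (W *\<^sub>v x)))"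
      unfolding t_def using T W iT x by (simp add: scalar_prod_add_distrib[of _ n])
    also have "x \<bullet> (W *\<^sub>v (mat_inv T *\<^sub>v (W *\<^sub>v x))) = w"
      unfolding w_def using symmetric_mat_scalar_prod[OF W x, of "mat_inv T *\<^sub>v (W *\<^sub>v x)"] iT Wx
      by simp
    finally show ?thesis .
  qed
  have "lo * (t + \<alpha> * d) \<le> lo * ((\<alpha> + ?M) * d)"
    using t(2) \<open>0 < lo\<close> by (intro mult_left_mono) (auto simp: algebra_simps)
  also have "\<dots> = (?m + (sigma_min W)\<^sup>2 / ?M) * d"
    unfolding lo_def using M \<alpha> by simp
  also have "\<dots> \<le> t + w" using t(1) w_lo by (simp add: distrib_right)
  finally show "lo * (x \<bullet> ((T + \<alpha> \<cdot>\<^sub>m 1\<^sub>m n) *\<^sub>v x)) \<le> x \<bullet> ((T + W * mat_inv T * W) *\<^sub>v x)"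
    unfolding B S .
  have "t + w \<le> (?M + (sigma_max W)\<^sup>2 / ?m) * d" using t(2) w_hi by (simp add: distrib_right)
  also have "\<dots> = hi * ((\<alpha> + ?m) * d)"
    unfolding hi_def using m \<alpha> by simp
  also have "\<dots> \<le> hi * (t + \<alpha> * d)"
    using t(1) \<open>0 \<le> hi\<close> by (intro mult_left_mono) (auto simp: algebra_simps)
  finally show "x \<bullet> ((T + W * mat_inv T * W) *\<^sub>v x) \<le> hi * (x \<bullet> ((T + \<alpha> \<cdot>\<^sub>m 1\<^sub>m n) *\<^sub>v x))"
    unfolding B S .
qed

theorem theorem3:
  fixes W T :: "real mat" and n :: nat and \<alpha> \<gamma> :: real
  defines "M \<equiv> mat_inv (P_VBP n \<alpha> \<gamma> W T) * block_A W T"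
    and "lo \<equiv> (lambda_min T + (sigma_min W)\<^sup>2 / lambda_max T) / (\<alpha> + lambda_max T)"
    and "hi \<equiv> (lambda_max T + (sigma_max W)\<^sup>2 / lambda_min T) / (\<alpha> + lambda_min T)"
  assumes W: "W \<in> carrier_mat n n" "symmetric_mat W" "indefinite_mat W"
    and T: "T \<in> carrier_mat n n" "symmetric_mat T" "pos_def_mat T"
    and pos: "\<alpha> > 0" "\<gamma> > 0"
    and alpha: "\<And>x. x \<in> carrier_vec n \<Longrightarrow> vec_norm2 x = 1 \<Longrightarrow>
      \<alpha> > 1 / 2 * Re (quad_form (cmat (W * mat_inv T * W)) x - quad_form (cmat T) x)"
  shows "invertible_mat (P_VBP n \<alpha> \<gamma> W T)
    \<and> eigenvalue (cmat M) 1
    \<and> n \<le> order 1 (char_poly (cmat M))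
    \<and> size (eigvals_mset M - replicate_mset n 1) = n
    \<and> (\<forall>z \<in># eigvals_mset M - replicate_mset n 1. z \<in> \<real> \<and> Re z \<in> {lo..hi})
    \<and> 0 < lo"
proof -
  define P B S H where "P = P_VBP n \<alpha> \<gamma> W T" and "B = T + \<alpha> \<cdot>\<^sub>m 1\<^sub>m n"
    and "S = T + W * mat_inv T * W" and "H = mat_inv B * S"
  have n: "0 < n"
    using W(1,3) eigenvalue_imp_nonzero_dim unfolding indefinite_mat_def by blast
  have det_T: "det T \<noteq> 0" using T pos_def_mat_det_nonzero by blast
  note iT = mat_inv_inverse[OF T(1) det_T]
  have B: "B \<in> carrier_mat n n" "symmetric_mat B"
    using T unfolding B_def symmetric_mat_def by (auto simp: transpose_add[of _ n n])
  have B_pd: "pos_def_mat B"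
  proof -
    have "0 < x \<bullet> (B *\<^sub>v x)" if x: "x \<in> carrier_vec n" "x \<noteq> 0\<^sub>v n" for x
    proof -
      have "0 < x \<bullet> (T *\<^sub>v x)" using T x unfolding pos_def_mat_def by auto
      moreover have "0 \<le> \<alpha> * (x \<bullet> x)" using pos real_scalar_prod_self(1)[OF x(1)] by simp
      ultimately show ?thesis
        unfolding B_def shifted_mat_quadratic_form[OF T(1) x(1)] by linarith
    qed
    then show ?thesis using B unfolding pos_def_mat_def by auto
  qed
  have det_B: "det B \<noteq> 0" by (rule pos_def_mat_det_nonzero[OF B(1) B_pd])
  note iB = mat_inv_inverse[OF B(1) det_B]
  have S: "S \<in> carrier_mat n n" "symmetric_mat S"
  proof -
    show "S \<in> carrier_mat n n" using T W iT unfolding S_def by simp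
    have "transpose_mat (W * mat_inv T * W) = W * mat_inv T * W"
      using W T iT symmetric_mat_inv[OF T(1,2) det_T] unfolding symmetric_mat_def
      by (simp add: transpose_mult[of _ n n _ n] assoc_mult_mat[of _ n n _ n _ n])
    then show "symmetric_mat S"
      using T W iT unfolding S_def symmetric_mat_def by (simp add: transpose_add[of _ n n])
  qed
  have H: "H \<in> carrier_mat n n" using iB S unfolding H_def by simp
  have "det P \<noteq> 0" and cp: "char_poly M = char_poly H * [:-1, 1:] ^ n"
    using char_poly_preconditioned[OF W(1) T(1) det_T det_B[unfolded B_def]]
    unfolding P_def M_def H_def B_def S_def by auto
  have P: "P \<in> carrier_mat (n + n) (n + n)"
    unfolding P_def P_VBP_expanded[OF W(1) T(1)] using T W by (intro four_block_carrier_mat) auto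
  note iP = mat_inv_inverse[OF P \<open>det P \<noteq> 0\<close>]
  have "invertible_mat P"
    using P iP unfolding invertible_mat_def inverts_mat_def by auto
  have M: "M \<in> carrier_mat (n + n) (n + n)"
    using iP T W unfolding M_def P_def block_A_def by auto
  interpret poly_hom: map_poly_comm_ring_hom complex_of_real ..
  have cM: "char_poly (cmat M) = char_poly (cmat H) * [:-1, 1:] ^ n"
    unfolding of_real_hom.char_poly_hom[OF M] of_real_hom.char_poly_hom[OF H] cp
    by (simp add: hom_distribs)
  have monic: "degree (char_poly (cmat H)) = n" "char_poly (cmat H) \<noteq> 0"
    using degree_monic_char_poly[of "cmat H" n] H by auto
  have ev_M: "eigvals_mset M = proots (char_poly (cmat H)) + replicate_mset n 1"
    unfolding eigvals_mset_def cM using monic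
    by (simp add: proots_mult proots_power)
  \<comment> \<open>The \<open>n\<close> removed copies of \<open>1\<close> come from the identity block, so that the full spectrum
    of \<open>H\<close> remains, even if \<open>1\<close> is also an eigenvalue of \<open>H\<close>.\<close>
  then have rest: "eigvals_mset M - replicate_mset n 1 = proots (char_poly (cmat H))" by simp
  have "char_poly (cmat M) \<noteq> 0" unfolding cM using monic by simp
  then have order: "n \<le> order 1 (char_poly (cmat M))"
    using arg_cong[OF ev_M, of "\<lambda>m. count m 1"] unfolding eigvals_mset_def by simp
  then have "eigenvalue (cmat M) 1"
    using n M eigenvalue_root_char_poly[of "cmat M" "n + n" 1] order_root by fastforce
  moreover have "size (eigvals_mset M - replicate_mset n 1) = n"
    unfolding rest using monic by (simp add: size_proots_complex)
  moreover have "z \<in> \<real> \<and> Re z \<in> {lo..hi}" if "z \<in># eigvals_mset M - replicate_mset n 1" for z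
  proof -
    have "eigenvalue (cmat H) z"
      using that monic H eigenvalue_root_char_poly[of "cmat H" n] unfolding rest by simp
    then show ?thesis
      unfolding H_def
      using symmetric_pencil_eigenvalue[OF S B B_pd]
        schur_complement_pencil_bounds(2,3)[OF W(1,2) T n pos(1)]
      unfolding lo_def hi_def B_def S_def by blast
  qed
  moreover have "0 < lo"
    unfolding lo_def using schur_complement_pencil_bounds(1)[OF W(1,2) T n pos(1)] zero_carrier_vec by blast
  ultimately show ?thesis using \<open>invertible_mat P\<close> order unfolding P_def by blast
qed

end
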